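(* Let $\{\mathcal{P}_n\}_{n\ge k}$ and $\{\mathcal{P}^*_n\}_{n\ge k}$, with $\mathcal{P}_n=\{P_{n,1},\dots,P_{n,n}\}$ and $\mathcal{P}_n^*=\{P_{n,1}^*,\dots,P_{n,n}^*\}$, be two triangular sequences of item response functions, each of which is a model (with latent trait $\Theta\sim U(0,1)$) for the same sequence of manifest distributions $\{\mathcal{F}_n\}_{n\ge k}$. Assume that Conditions 1--4 (stated in the context) hold for each of the two sequences. Then $$\lim_{n\to\infty}\ \max_{1\le i\le n}\ \sup_{\theta\in(0,1)}\left|P_{n,i}(\theta)-P^*_{n,i}(\theta)\right|=0.$$
   Context: Setting. Fix a starting integer $k\ge 1$. For each $n\ge k$, $\boldsymbol{Y}_n=(Y_{n,1},\dots,Y_{n,n})$ is a vector of $\{0,1\}$-valued random variables with distribution $\mathcal{F}_n$ (the manifest distribution); no relation is required between $\boldsymbol{Y}_n$ for different $n$. A triangular sequence of item response functions (IRFs) is a family $\{P_{n,i}: n\ge k,\ 1\le i\le n\}$ of functions $P_{n,i}:[0,1]\to[0,1]$. Model. The IRF sequence, coupled with the density of $\Theta\sim U(0,1)$, is a model for $\{\mathcal{F}_n\}$ if for each $n\ge k$ and each nonempty subset $\{i_1,\dots,i_r\}\subseteq\{1,\dots,n\}$, $$P[Y_{n,i_1}=1,\dots,Y_{n,i_r}=1]=\int_0^1\prod_{j=1}^r P_{n,i_j}(\theta)\,d\theta .$$ Here $P_{n,i}(\theta)=P(Y_{n,i}=1\mid\Theta=\theta)$. Condition 1 (unidimensionality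 and local independence). The latent variable $\Theta$ is a scalar random variable, and the item responses $Y_{n,1},\dots,Y_{n,n}$ are mutually independent conditionally on $\Theta$. Condition 2. $\Theta\sim U(0,1)$. Condition 3. For each $(n,i)$ the derivative $P'_{n,i}$ exists and is continuous on $(0,1)$. For all $0<\alpha<\beta<1$ there exist constants $m_{\alpha\beta},M_{\alpha\beta}$, not depending on $(n,i)$, such that $0<m_{\alpha\beta}<P'_{n,i}(\theta)<M_{\alpha\beta}<\infty$ for all $\theta\in[\alpha,\beta]$ and all $(n,i)$. Condition 4. For each $(n,i)$ there exist constants $\kappa_{n,i}<\gamma_{n,i}$ in $[0,1]$ such that $P_{n,i}(\theta)\in[\kappa_{n,i},\gamma_{n,i}]$ for all $\theta$. Moreover, for any $\epsilon>0$ there exist $l_\epsilon,u_\epsilon\in(0,1)$ (not depending on $(n,i)$) such that for all $(n,i)$, $$\sup_{\theta\in[0,l_\epsilon]}[P_{n,i}(\theta)-\kappa_{n,i}]\le\epsilon\quad\text{and}\quad\sup_{\theta\in[u_\epsilon,1]}[\gamma_{n,i}-P_{n,i}(\theta)]\le\epsilon .$$ The conditions for the starred sequence are the same with $P^*_{n,i}$ in place of $P_{n,i}$ (with its own constants). *)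

theory Defs
  imports "HOL-Probability.Probability"
begin

definition response_vector ::
  "nat \<Rightarrow> 'a measure \<Rightarrow> (nat \<Rightarrow> 'a \<Rightarrow> nat) \<Rightarrow> (nat \<Rightarrow> nat) measure \<Rightarrow> bool" where
  "response_vector n \<Omega> Y F \<longleftrightarrow>
     prob_space \<Omega> \<and>
     (\<forall>i\<in>{1..n}. Y i \<in> \<Omega> \<rightarrow>\<^sub>M count_space {0, 1}) \<and>
     F = distr \<Omega> (\<Pi>\<^sub>M i\<in>{1..n}. count_space {0, 1}) (\<lambda>\<omega>. \<lambda>i\<in>{1..n}. Y i \<omega>)"

definition latent_algebra :: "'a measure \<Rightarrow> ('a \<Rightarrow> real) \<Rightarrow> 'a measure" where
  "latent_algebra \<Omega> \<Theta> = vimage_algebra (space \<Omega>) \<Theta> borel"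

definition cond_prob_latent :: "'a measure \<Rightarrow> ('a \<Rightarrow> real) \<Rightarrow> 'a set \<Rightarrow> 'a \<Rightarrow> real" where
  "cond_prob_latent \<Omega> \<Theta> E = real_cond_exp \<Omega> (latent_algebra \<Omega> \<Theta>) (indicator E)"

definition locally_independent ::
  "nat \<Rightarrow> 'a measure \<Rightarrow> ('a \<Rightarrow> real) \<Rightarrow> (nat \<Rightarrow> 'a \<Rightarrow> nat) \<Rightarrow> bool" where
  "locally_independent n \<Omega> \<Theta> Y \<longleftrightarrow>
     \<Theta> \<in> borel_measurable \<Omega> \<and>
     (\<forall>J A. J \<subseteq> {1..n} \<and> J \<noteq> {} \<and> (\<forall>j\<in>J. A j \<subseteq> {0, 1}) \<longrightarrow>
        (AE \<omega> in \<Omega>.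
           cond_prob_latent \<Omega> \<Theta> {\<omega>'\<in>space \<Omega>. \<forall>j\<in>J. Y j \<omega>' \<in> A j} \<omega> =
           (\<Prod>j\<in>J. cond_prob_latent \<Omega> \<Theta> {\<omega>'\<in>space \<Omega>. Y j \<omega>' \<in> A j} \<omega>)))"

definition uniform_latent :: "'a measure \<Rightarrow> ('a \<Rightarrow> real) \<Rightarrow> bool" where
  "uniform_latent \<Omega> \<Theta> \<longleftrightarrow>
     \<Theta> \<in> borel_measurable \<Omega> \<and> distr \<Omega> borel \<Theta> = uniform_measure lborel {0<..<1}"

(* P i is a version of the conditional probability P(Y i = 1 | \<Theta> = \<theta>). *)
definition response_functions ::
  "nat \<Rightarrow> 'a measure \<Rightarrow> ('a \<Rightarrow> real) \<Rightarrow> (nat \<Rightarrow> 'a \<Rightarrow> nat) \<Rightarrow> (nat \<Rightarrow> real \<Rightarrow> real) \<Rightarrow> bool" where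
  "response_functions n \<Omega> \<Theta> Y P \<longleftrightarrow>
     (\<forall>i\<in>{1..n}. AE \<omega> in \<Omega>.
        cond_prob_latent \<Omega> \<Theta> {\<omega>'\<in>space \<Omega>. Y i \<omega>' = 1} \<omega> = P i (\<Theta> \<omega>))"

definition irf_sequence :: "nat \<Rightarrow> (nat \<Rightarrow> nat \<Rightarrow> real \<Rightarrow> real) \<Rightarrow> bool" where
  "irf_sequence k P \<longleftrightarrow> (\<forall>n\<ge>k. \<forall>i\<in>{1..n}. P n i \<in> {0..1} \<rightarrow> {0..1})"

definition is_model ::
  "nat \<Rightarrow> (nat \<Rightarrow> nat \<Rightarrow> real \<Rightarrow> real) \<Rightarrow> (nat \<Rightarrow> (nat \<Rightarrow> nat) measure) \<Rightarrow> bool" where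
  "is_model k P F \<longleftrightarrow>
     (\<forall>n\<ge>k. \<forall>I. I \<subseteq> {1..n} \<and> I \<noteq> {} \<longrightarrow>
        measure (F n) {y \<in> space (F n). \<forall>i\<in>I. y i = 1} =
        (LINT \<theta>:{0..1}|lborel. (\<Prod>i\<in>I. P n i \<theta>)))"

definition smooth_increasing :: "nat \<Rightarrow> (nat \<Rightarrow> nat \<Rightarrow> real \<Rightarrow> real) \<Rightarrow> bool" where
  "smooth_increasing k P \<longleftrightarrow>
     (\<forall>n\<ge>k. \<forall>i\<in>{1..n}.
        (\<forall>\<theta>\<in>{0<..<1}. P n i differentiable (at \<theta>)) \<and>
        continuous_on {0<..<1} (deriv (P n i))) \<and>
     (\<forall>\<alpha> \<beta>. 0 < \<alpha> \<and> \<alpha> < \<beta> \<and> \<beta> < 1 \<longrightarrow>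
        (\<exists>m M. 0 < m \<and>
           (\<forall>n\<ge>k. \<forall>i\<in>{1..n}. \<forall>\<theta>\<in>{\<alpha>..\<beta>}.
              m < deriv (P n i) \<theta> \<and> deriv (P n i) \<theta> < M)))"

definition uniform_tails :: "nat \<Rightarrow> (nat \<Rightarrow> nat \<Rightarrow> real \<Rightarrow> real) \<Rightarrow> bool" where
  "uniform_tails k P \<longleftrightarrow>
     (\<exists>\<kappa> \<gamma> :: nat \<Rightarrow> nat \<Rightarrow> real.
        (\<forall>n\<ge>k. \<forall>i\<in>{1..n}.
           0 \<le> \<kappa> n i \<and> \<kappa> n i < \<gamma> n i \<and> \<gamma> n i \<le> 1 \<and>
           (\<forall>\<theta>\<in>{0..1}. P n i \<theta> \<in> {\<kappa> n i..\<gamma> n i})) \<and>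
        (\<forall>\<epsilon>>0. \<exists>l\<in>{0<..<1}. \<exists>u\<in>{0<..<1}.
           \<forall>n\<ge>k. \<forall>i\<in>{1..n}.
             (SUP \<theta>\<in>{0..l}. P n i \<theta> - \<kappa> n i) \<le> \<epsilon> \<and>
             (SUP \<theta>\<in>{u..1}. \<gamma> n i - P n i \<theta>) \<le> \<epsilon>))"

end

theory Submission
  imports Defs
begin

text \<open>
  Write \<open>s n\<close> for the average of the functions \<open>P n i\<close>. A product of \<open>s n ^ d\<close> with at most one further
  \<open>P n i\<close> expands into products of the \<open>P n i\<close>, of which all but a proportion \<open>O(1/n)\<close> have
  distinct indices, so up to \<open>O(1/n)\<close> its integral is determined by the manifest distribution. By
  Weierstrass the same holds for \<open>P n i * h (s n - c)\<close> with continuous \<open>h\<close>. Since the averages are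
  increasing with locally bounded slope, a ramp \<open>h\<close> shows that the averages of the two models approach
  each other. A narrow tent \<open>h\<close> then isolates \<open>P n i\<close> near any point, so the individual functions
  approach each other locally uniformly, and the tail condition extends this to all of \<open>(0,1)\<close>.
\<close>

subsection \<open>Mixed moments of an average\<close>

lemma (in prob_space) integral_unit_interval:
  fixes f :: "'a \<Rightarrow> real"
  assumes "f \<in> borel_measurable M" "\<And>x. x \<in> space M \<Longrightarrow> f x \<in> {0..1}"
  shows "integrable M f" "integral\<^sup>L M f \<in> {0..1}"
proof -
  show "integrable M f"
    using assms by (intro integrable_const_bound[where B = 1] AE_I2) auto
  then show "integral\<^sup>L M f \<in> {0..1}"
    using assms(2) by (auto intro!: integral_le_const integral_ge_const AE_I2)
qed

lemma average_in_unit_interval: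
  fixes f :: "'i \<Rightarrow> real"
  assumes "\<And>i. i \<in> A \<Longrightarrow> f i \<in> {0..1}"
  shows "(\<Sum>i\<in>A. f i) / card A \<in> {0..1}"
proof -
  have "(\<Sum>i\<in>A. f i) \<le> card A"
    using assms sum_bounded_above[of A f 1] by simp
  moreover have "0 \<le> (\<Sum>i\<in>A. f i)"
    using assms by (simp add: sum_nonneg)
  ultimately show ?thesis
    by (cases "card A = 0") (simp_all add: divide_le_eq_1)
qed

lemma mult_in_unit: "(a::real) \<in> {0..1} \<Longrightarrow> b \<in> {0..1} \<Longrightarrow> a * b \<in> {0..1}"
  by (auto intro: mult_le_one)
lemma power_in_unit: "(a::real) \<in> {0..1} \<Longrightarrow> a ^ d \<in> {0..1}"
  by (auto intro: power_le_one)

text \<open>One factor of the power is written as an average over \<open>j\<close> and the sum is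
  pulled out. The crude range in the second claim serves the indices \<open>j\<close> already in
  \<open>I\<close>, where the product acquires a repeated factor.\<close>

lemma (in prob_space) mixed_moment_step:
  fixes p :: "'i \<Rightarrow> 'a \<Rightarrow> real"
  assumes p: "\<And>i. i \<in> A \<Longrightarrow> p i \<in> borel_measurable M"
      "\<And>i x. i \<in> A \<Longrightarrow> x \<in> space M \<Longrightarrow> p i x \<in> {0..1}"
    and I: "I \<subseteq> A"
  shows "(\<integral>x. (\<Prod>i\<in>I. p i x) * ((\<Sum>i\<in>A. p i x) / card A) ^ Suc d \<partial>M) =
    (\<Sum>j\<in>A. \<integral>x. p j x * (\<Prod>i\<in>I. p i x) * ((\<Sum>i\<in>A. p i x) / card A) ^ d \<partial>M) / card A" (is ?eq)
    and "j \<in> A \<Longrightarrow> (\<integral>x. p j x * (\<Prod>i\<in>I. p i x) * ((\<Sum>i\<in>A. p i x) / card A) ^ d \<partial>M) \<in> {0..1}"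
proof -
  let ?f = "\<lambda>j x. p j x * (\<Prod>i\<in>I. p i x) * ((\<Sum>i\<in>A. p i x) / card A) ^ d"
  have [measurable]: "\<And>i. i \<in> A \<Longrightarrow> p i \<in> borel_measurable M"
    "\<And>i. i \<in> I \<Longrightarrow> p i \<in> borel_measurable M"
    using p I by auto
  have meas: "?f j \<in> borel_measurable M" if "j \<in> A" for j
    using that by measurable
  have unit: "?f j x \<in> {0..1}" if "j \<in> A" "x \<in> space M" for j x
  proof -
    have "(\<Prod>i\<in>I. p i x) \<in> {0..1}"
      using p(2)[OF _ that(2)] I by (auto intro!: prod_nonneg prod_le_1)
    moreover have "((\<Sum>i\<in>A. p i x) / card A) ^ d \<in> {0..1}"
      using p(2)[OF _ that(2)] by (intro power_in_unit average_in_unit_interval)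
    ultimately show ?thesis
      using p(2)[OF that] by (intro mult_in_unit)
  qed
  show "integral\<^sup>L M (?f j) \<in> {0..1}" if "j \<in> A" for j
    using integral_unit_interval meas unit that by blast
  have factor: "a * (b / c) ^ Suc d = b * a * (b / c) ^ d / c" for a b c :: real
    by simp
  have "(\<integral>x. (\<Prod>i\<in>I. p i x) * ((\<Sum>i\<in>A. p i x) / card A) ^ Suc d \<partial>M) =
      (\<integral>x. (\<Sum>j\<in>A. ?f j x) / card A \<partial>M)"
    unfolding factor sum_distrib_right by (rule refl)
  also have "\<dots> = (\<Sum>j\<in>A. integral\<^sup>L M (?f j)) / card A"
    unfolding integral_divide_zero using integral_unit_interval(1)[OF meas unit]
    by (subst Bochner_Integration.integral_sum) simp_all
  finally show ?eq .
qed

text \<open>Induction on the exponent with \<open>I\<close> arbitrary: each peeled index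
  \<open>j\<close> outside \<open>I\<close> is absorbed into the product, which stays free of
  repetitions, and the induction hypothesis applies to \<open>insert j I\<close>. The at most
  \<open>card I\<close> repeated indices differ by at most 1 each, which the division by
  \<open>card A\<close> makes small.\<close>

lemma (in prob_space) moment_average_diff:
  fixes p q :: "'i \<Rightarrow> 'a \<Rightarrow> real"
  assumes p: "\<And>i. i \<in> A \<Longrightarrow> p i \<in> borel_measurable M"
      "\<And>i x. i \<in> A \<Longrightarrow> x \<in> space M \<Longrightarrow> p i x \<in> {0..1}"
    and q: "\<And>i. i \<in> A \<Longrightarrow> q i \<in> borel_measurable M"
      "\<And>i x. i \<in> A \<Longrightarrow> x \<in> space M \<Longrightarrow> q i x \<in> {0..1}"
    and eq: "\<And>I. I \<subseteq> A \<Longrightarrow> (\<integral>x. (\<Prod>i\<in>I. p i x) \<partial>M) = (\<integral>x. (\<Prod>i\<in>I. q i x) \<partial>M)"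
    and A: "finite A" "A \<noteq> {}"
    and I: "I \<subseteq> A"
  shows "\<bar>(\<integral>x. (\<Prod>i\<in>I. p i x) * ((\<Sum>i\<in>A. p i x) / card A) ^ d \<partial>M) -
          (\<integral>x. (\<Prod>i\<in>I. q i x) * ((\<Sum>i\<in>A. q i x) / card A) ^ d \<partial>M)\<bar>
        \<le> real (d * (card I + d)) / card A"
  using I
proof (induction d arbitrary: I)
  case 0
  then show ?case by (simp add: eq)
next
  case (Suc d)
  let ?T = "\<lambda>r j. \<integral>x. r j x * (\<Prod>i\<in>I. r i x) * ((\<Sum>i\<in>A. r i x) / card A) ^ d \<partial>M"
  let ?D = "\<lambda>j. \<bar>?T p j - ?T q j\<bar>"
  let ?b = "real (d * (Suc (card I) + d)) / card A"
  have fin: "finite I" using Suc.prems A finite_subset by blast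
  have card: "card A > 0" using A by (simp add: card_gt_0_iff)
  have diff_le_1: "\<bar>a - b\<bar> \<le> 1" if "a \<in> {0..1}" "b \<in> {0..1}" for a b :: real
    using that by auto
  have in_I: "?D j \<le> 1" if "j \<in> I" for j
    using that Suc.prems
    by (intro diff_le_1 mixed_moment_step(2) p q) auto
  have out_I: "?D j \<le> ?b" if "j \<in> A - I" for j
  proof -
    have j: "j \<notin> I" "insert j I \<subseteq> A" using that Suc.prems by auto
    show ?thesis
      using Suc.IH[OF j(2)] unfolding prod.insert[OF fin j(1)] card_insert_disjoint[OF fin j(1)] by assumption
  qed
  have "\<bar>(\<Sum>j\<in>A. ?T p j) - (\<Sum>j\<in>A. ?T q j)\<bar> \<le> (\<Sum>j\<in>A. ?D j)"
    unfolding sum_subtractf[symmetric] by (rule sum_abs)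
  also have "\<dots> = (\<Sum>j\<in>A - I. ?D j) + (\<Sum>j\<in>I. ?D j)"
    using A Suc.prems by (intro sum.subset_diff) 
  also have "(\<Sum>j\<in>I. ?D j) \<le> card I"
    using sum_bounded_above[of I ?D 1] in_I by simp
  also have "(\<Sum>j\<in>A - I. ?D j) \<le> card (A - I) * ?b"
    using sum_bounded_above[of "A - I" ?D ?b] out_I by simp
  also have "card (A - I) * ?b \<le> card A * ?b"
    using A by (intro mult_right_mono) (auto intro!: card_mono)
  also have "card A * ?b = real (d * (Suc (card I) + d))"
    using card by simp
  finally have "\<bar>(\<Sum>j\<in>A. ?T p j) - (\<Sum>j\<in>A. ?T q j)\<bar> \<le> real (d * (Suc (card I) + d)) + card I"
    by simp
  \<comment> \<open>The claimed bound exceeds the accumulated one by exactly \<open>d + 1\<close>,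
    so the recursion closes.\<close>
  also have "\<dots> \<le> real (Suc d * (card I + Suc d))"
    unfolding of_nat_add[symmetric] of_nat_le_iff by (simp add: algebra_simps)
  finally have "\<bar>(\<Sum>j\<in>A. ?T p j) - (\<Sum>j\<in>A. ?T q j)\<bar> / card A
      \<le> real (Suc d * (card I + Suc d)) / card A"
    by (intro divide_right_mono) auto
  moreover have "(\<integral>x. (\<Prod>i\<in>I. p i x) * ((\<Sum>i\<in>A. p i x) / card A) ^ Suc d \<partial>M) = (\<Sum>j\<in>A. ?T p j) / card A"
    by (intro mixed_moment_step(1) p Suc.prems)
  moreover have "(\<integral>x. (\<Prod>i\<in>I. q i x) * ((\<Sum>i\<in>A. q i x) / card A) ^ Suc d \<partial>M) = (\<Sum>j\<in>A. ?T q j) / card A"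
    by (intro mixed_moment_step(1) q Suc.prems)
  ultimately show ?case
    by (simp only: diff_divide_distrib[symmetric] abs_divide abs_of_nat)
qed

section \<open>Lipschitz cut-off functions\<close>

lemma ramp_lipschitz: "\<bar>max 0 (min s (s - x)) - max 0 (min s (s - y))\<bar> \<le> \<bar>x - y\<bar>" for s x y :: real
  by (auto simp: max_def min_def abs_if)

lemma tent_lipschitz: "\<bar>max 0 (r - \<bar>x\<bar>) - max 0 (r - \<bar>y\<bar>)\<bar> \<le> \<bar>x - y\<bar>" for r x y :: real
  by (auto simp: max_def abs_if)

subsection \<open>Arrays of item response functions\<close>

text \<open>The law of \<open>\<Theta>\<close>. The open interval is chosen because the derivative
  conditions, and with them continuity and monotonicity, speak only about interior points.\<close>

definition unit_space :: "real measure" where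
  "unit_space = restrict_space lborel {0<..<1}"

lemma space_unit_space [simp]: "space unit_space = {0<..<1}"
  by (simp add: unit_space_def space_restrict_space)

interpretation unit_space: prob_space unit_space
  unfolding unit_space_def by (rule prob_space_restrict_space) auto

lemma measure_unit_space_interval:
  assumes "0 \<le> a" "a \<le> b" "b \<le> 1"
  shows "{a<..<b} \<in> sets unit_space" "measure unit_space {a<..<b} = b - a"
proof -
  have "{a<..<b} \<subseteq> {0<..<1}" using assms by auto
  then show "{a<..<b} \<in> sets unit_space" "measure unit_space {a<..<b} = b - a"
    using assms by (auto simp: unit_space_def sets_restrict_space_iff measure_restrict_space)
qed

lemma integral_unit_space_indicator:
  fixes s :: real
  assumes "0 \<le> a" "a \<le> b" "b \<le> 1"
  shows "integrable unit_space (\<lambda>x. s * indicator {a<..<b} x)"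
    and "(\<integral>x. s * indicator {a<..<b} x \<partial>unit_space) = s * (b - a)"
proof -
  note interval = measure_unit_space_interval[OF assms]
  have "integrable unit_space (indicator {a<..<b} :: real \<Rightarrow> real)"
    using interval(1) by (intro integrable_real_indicator) (auto simp: less_top[symmetric])
  then show "integrable unit_space (\<lambda>x. s * indicator {a<..<b} x)"
    by (rule integrable_mult_right)
  have "{a<..<b} \<inter> space unit_space = {a<..<b}"
    using assms by auto
  then show "(\<integral>x. s * indicator {a<..<b} x \<partial>unit_space) = s * (b - a)"
    by (simp only: integral_mult_right_zero Bochner_Integration.integral_indicator interval(2))
qed

text \<open>The endpoints form a null set; this carries the integrals in \<open>is_model\<close>
  over to \<open>unit_space\<close>.\<close>

lemma set_integral_unit_space:
  fixes f :: "real \<Rightarrow> real"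
  shows "(LINT \<theta>:{0..1}|lborel. f \<theta>) = (\<integral>\<theta>. f \<theta> \<partial>unit_space)"
proof -
  have "(\<integral>\<theta>. indicator {0..1} \<theta> *\<^sub>R f \<theta> \<partial>lborel) = (\<integral>\<theta>. indicator {0<..<1} \<theta> *\<^sub>R f \<theta> \<partial>lborel)"
    by (rule integral_discrete_difference[where X = "{0, 1}"]) (auto simp: indicator_def)
  then show ?thesis
    by (simp add: set_lebesgue_integral_def unit_space_def integral_restrict_space)
qed

text \<open>The average \<open>s n\<close> of the outline: the expected proportion of responses
  equal to 1, given the trait.\<close>

definition test_score :: "(nat \<Rightarrow> nat \<Rightarrow> real \<Rightarrow> real) \<Rightarrow> nat \<Rightarrow> real \<Rightarrow> real" where
  "test_score P n \<theta> = (\<Sum>i\<in>{1..n}. P n i \<theta>) / n"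

section \<open>Analytic properties of a single array\<close>

locale irf_array =
  fixes k :: nat and P :: "nat \<Rightarrow> nat \<Rightarrow> real \<Rightarrow> real"
  assumes k_pos: "k \<ge> 1"
    and irf: "irf_sequence k P"
    and smooth: "smooth_increasing k P"
    and tails: "uniform_tails k P"
begin

lemma irf_unit: "n \<ge> k \<Longrightarrow> i \<in> {1..n} \<Longrightarrow> \<theta> \<in> {0..1} \<Longrightarrow> P n i \<theta> \<in> {0..1}"
  using irf unfolding irf_sequence_def by blast

lemma has_deriv:
  assumes "n \<ge> k" "i \<in> {1..n}" "\<theta> \<in> {0<..<1}"
  shows "(P n i has_real_derivative deriv (P n i) \<theta>) (at \<theta>)"
proof -
  have "P n i differentiable (at \<theta>)"
    using assms smooth unfolding smooth_increasing_def by blast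
  then show ?thesis
    by (simp add: DERIV_deriv_iff_real_differentiable)
qed

text \<open>The mean value theorem turns the derivative bounds into increment bounds. The constants
  are chosen before \<open>n\<close> and \<open>i\<close>, so they survive averaging and hold for
  the scores too.\<close>

lemma increment_bounds:
  assumes "0 < a" "a < b" "b < 1"
  shows "\<exists>m>0. \<exists>K>0. \<forall>n\<ge>k. \<forall>i\<in>{1..n}. \<forall>x y. a \<le> x \<and> x \<le> y \<and> y \<le> b \<longrightarrow>
    m * (y - x) \<le> P n i y - P n i x \<and> P n i y - P n i x \<le> K * (y - x)"
proof -
  obtain m K where m: "0 < m" and D: "\<And>n i \<theta>. n \<ge> k \<Longrightarrow> i \<in> {1..n} \<Longrightarrow> \<theta> \<in> {a..b} \<Longrightarrow>
      m < deriv (P n i) \<theta> \<and> deriv (P n i) \<theta> < K"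
    using smooth assms unfolding smooth_increasing_def by meson
  have bounds: "m * (y - x) \<le> P n i y - P n i x \<and> P n i y - P n i x \<le> K * (y - x)"
    if ni: "n \<ge> k" "i \<in> {1..n}" and xy: "a \<le> x" "x \<le> y" "y \<le> b" for n i x y
  proof (cases "x = y")
    case False
    have "(P n i has_real_derivative deriv (P n i) z) (at z)" if "x \<le> z" "z \<le> y" for z
      using has_deriv[OF ni] that xy assms by simp
    then obtain z where z: "x < z" "z < y" "P n i y - P n i x = (y - x) * deriv (P n i) z"
      using MVT2[of x y "P n i" "deriv (P n i)"] False xy(2) by auto
    then have "m \<le> deriv (P n i) z" "deriv (P n i) z \<le> K"
      using D[OF ni, of z] xy by auto
    with xy z show ?thesis
      by (simp add: mult.commute[of "y - x"] mult_right_mono)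
  qed simp
  \<comment> \<open>The item \<open>(k, 1)\<close> exists because \<open>k \<ge> 1\<close>; its
    derivative at \<open>a\<close> lies strictly between the two constants.\<close>
  have "m < K"
    using D[of k 1 a] k_pos assms by fastforce
  with m have "0 < K" by simp
  with m bounds show ?thesis by blast
qed

lemma irf_mono:
  assumes "n \<ge> k" "i \<in> {1..n}" "0 < x" "x \<le> y" "y < 1"
  shows "P n i x \<le> P n i y"
proof (cases "x = y")
  case False
  with assms have "x < y" by simp
  \<comment> \<open>The interval from \<open>x\<close> to \<open>y\<close> itself is used;
    \<open>m\<close> may depend on it, since only its sign matters.\<close>
  then obtain m where "0 < m" "m * (y - x) \<le> P n i y - P n i x"
    using increment_bounds[of x y] assms by (meson order_refl)
  moreover from this have "0 \<le> m * (y - x)"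
    using assms by simp
  ultimately show ?thesis by linarith
qed simp

lemma irf_measurable:
  assumes "n \<ge> k" "i \<in> {1..n}"
  shows "P n i \<in> borel_measurable unit_space"
proof -
  have "continuous_on {0<..<1} (P n i)"
    using DERIV_isCont[OF has_deriv[OF assms]] by (intro continuous_at_imp_continuous_on ballI)
  then have "P n i \<in> borel_measurable (restrict_space borel {0<..<1})"
    by (rule borel_measurable_continuous_on_restrict)
  then show ?thesis
    by (simp add: unit_space_def cong: measurable_cong_sets sets_restrict_space_cong)
qed

lemma test_score_unit: "n \<ge> k \<Longrightarrow> \<theta> \<in> {0..1} \<Longrightarrow> test_score P n \<theta> \<in> {0..1}"
  using average_in_unit_interval[of "{1..n}" "\<lambda>i. P n i \<theta>"] irf_unit
  by (simp add: test_score_def)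

lemma test_score_measurable: "n \<ge> k \<Longrightarrow> test_score P n \<in> borel_measurable unit_space"
  unfolding test_score_def using irf_measurable by measurable

lemma test_score_diff:
  "test_score P n y - test_score P n x = (\<Sum>i\<in>{1..n}. P n i y - P n i x) / n"
  by (simp add: test_score_def sum_subtractf diff_divide_distrib)

lemma test_score_mono:
  assumes "n \<ge> k" "0 < x" "x \<le> y" "y < 1"
  shows "test_score P n x \<le> test_score P n y"
  unfolding test_score_def using assms irf_mono by (intro divide_right_mono sum_mono) auto

lemma test_score_increment_ge:
  assumes "n \<ge> k" "\<And>i. i \<in> {1..n} \<Longrightarrow> a \<le> P n i y - P n i x"
  shows "a \<le> test_score P n y - test_score P n x"
proof -
  have "n * a \<le> (\<Sum>i\<in>{1..n}. P n i y - P n i x)"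
    using sum_bounded_below[of "{1..n}" a] assms(2) by simp
  then show ?thesis
    unfolding test_score_diff using assms(1) k_pos by (simp add: field_simps)
qed

lemma test_score_increment_le:
  assumes "n \<ge> k" "\<And>i. i \<in> {1..n} \<Longrightarrow> P n i y - P n i x \<le> b"
  shows "test_score P n y - test_score P n x \<le> b"
proof -
  have "(\<Sum>i\<in>{1..n}. P n i y - P n i x) \<le> n * b"
    using sum_bounded_above[of "{1..n}" _ b] assms(2) by simp
  then show ?thesis
    unfolding test_score_diff using assms(1) k_pos by (simp add: field_simps)
qed

lemma prod_irf_unit:
  assumes "n \<ge> k" "I \<subseteq> {1..n}" "\<theta> \<in> {0<..<1}"
  shows "(\<Prod>i\<in>I. P n i \<theta>) \<in> {0..1}"
proof -
  have "P n i \<theta> \<in> {0..1}" if "i \<in> I" for i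
    using irf_unit[of n i \<theta>] assms that by fastforce
  then show ?thesis
    by (auto intro!: prod_nonneg prod_le_1)
qed

lemma integrable_prod_test_score:
  assumes n: "n \<ge> k" and I: "I \<subseteq> {1..n}" and f: "continuous_on UNIV (f :: real \<Rightarrow> real)"
  shows "integrable unit_space (\<lambda>\<theta>. (\<Prod>i\<in>I. P n i \<theta>) * f (test_score P n \<theta>))"
proof -
  have "bounded (f ` {0..1})"
    by (meson compact_Icc compact_continuous_image compact_imp_bounded continuous_on_subset f subset_UNIV)
  then obtain B where B: "\<forall>x\<in>{0..1}. \<bar>f x\<bar> \<le> B"
    unfolding bounded_iff by auto
  have [measurable]: "f \<in> borel_measurable borel"
    using f by (rule borel_measurable_continuous_onI)
  have [measurable]: "\<And>i. i \<in> I \<Longrightarrow> P n i \<in> borel_measurable unit_space"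
    using irf_measurable[OF n] I by auto
  note test_score_measurable[OF n, measurable]
  have "\<bar>(\<Prod>i\<in>I. P n i \<theta>) * f (test_score P n \<theta>)\<bar> \<le> B" if "\<theta> \<in> {0<..<1}" for \<theta>
  proof -
    have "\<bar>\<Prod>i\<in>I. P n i \<theta>\<bar> * \<bar>f (test_score P n \<theta>)\<bar> \<le> 1 * B"
      using prod_irf_unit[OF n I that] B test_score_unit[OF n, of \<theta>] that
      by (intro mult_mono) auto
    then show ?thesis by (simp add: abs_mult)
  qed
  then show ?thesis
    by (intro unit_space.integrable_const_bound[where B = B] AE_I2) auto
qed

lemma integral_prod_test_score_close:
  assumes n: "n \<ge> k" and I: "I \<subseteq> {1..n}"
    and f: "continuous_on UNIV (f :: real \<Rightarrow> real)" and g: "continuous_on UNIV (g :: real \<Rightarrow> real)"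
    and close: "\<And>x. x \<in> {0..1} \<Longrightarrow> \<bar>f x - g x\<bar> \<le> e"
  shows "\<bar>(\<integral>\<theta>. (\<Prod>i\<in>I. P n i \<theta>) * f (test_score P n \<theta>) \<partial>unit_space) -
      (\<integral>\<theta>. (\<Prod>i\<in>I. P n i \<theta>) * g (test_score P n \<theta>) \<partial>unit_space)\<bar> \<le> e" (is "\<bar>integral\<^sup>L _ ?F - integral\<^sup>L _ ?G\<bar> \<le> e")
proof -
  have int: "integrable unit_space ?F" "integrable unit_space ?G"
    using integrable_prod_test_score n I f g by blast+
  have "?F \<theta> - ?G \<theta> \<le> e \<and> - e \<le> ?F \<theta> - ?G \<theta>" if "\<theta> \<in> {0<..<1}" for \<theta>
  proof -
    have "\<bar>\<Prod>i\<in>I. P n i \<theta>\<bar> * \<bar>f (test_score P n \<theta>) - g (test_score P n \<theta>)\<bar> \<le> 1 * e"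
      using prod_irf_unit[OF n I that] close test_score_unit[OF n, of \<theta>] that
      by (intro mult_mono) auto
    then have "\<bar>?F \<theta> - ?G \<theta>\<bar> \<le> e" by (simp only: abs_mult[symmetric] right_diff_distrib mult_1_left)
    then show ?thesis by linarith
  qed
  then have "(\<integral>\<theta>. ?F \<theta> - ?G \<theta> \<partial>unit_space) \<le> e" "- e \<le> (\<integral>\<theta>. ?F \<theta> - ?G \<theta> \<partial>unit_space)"
    using int by (auto intro!: unit_space.integral_le_const unit_space.integral_ge_const AE_I2
        simp del: Bochner_Integration.integral_diff)
  then show ?thesis using int by simp
qed

text \<open>Near 0 all values of \<open>P n i\<close> lie within \<open>e\<close> above
  \<open>\<kappa> n i\<close>, near 1 within \<open>e\<close> below \<open>\<gamma> n i\<close>;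
  hence any two of them differ by at most \<open>e\<close>. This form no longer mentions the
  asymptotes, which could differ between the two models.\<close>

lemma irf_tails:
  assumes "e > 0"
  shows "\<exists>l\<in>{0<..<1}. \<exists>u\<in>{0<..<1}. \<forall>n\<ge>k. \<forall>i\<in>{1..n}.
    (\<forall>x\<in>{0..l}. \<forall>y\<in>{0..l}. \<bar>P n i x - P n i y\<bar> \<le> e) \<and>
    (\<forall>x\<in>{u..1}. \<forall>y\<in>{u..1}. \<bar>P n i x - P n i y\<bar> \<le> e)"
proof -
  obtain \<kappa> \<gamma> :: "nat \<Rightarrow> nat \<Rightarrow> real"
    where range: "\<And>n i \<theta>. n \<ge> k \<Longrightarrow> i \<in> {1..n} \<Longrightarrow> \<theta> \<in> {0..1} \<Longrightarrow> P n i \<theta> \<in> {\<kappa> n i..\<gamma> n i}"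
      and ex: "\<forall>\<epsilon>>0. \<exists>l\<in>{0<..<1}. \<exists>u\<in>{0<..<1}. \<forall>n\<ge>k. \<forall>i\<in>{1..n}.
             (SUP \<theta>\<in>{0..l}. P n i \<theta> - \<kappa> n i) \<le> \<epsilon> \<and>
             (SUP \<theta>\<in>{u..1}. \<gamma> n i - P n i \<theta>) \<le> \<epsilon>"
    using tails unfolding uniform_tails_def by blast
  obtain l u where lu: "l \<in> {0<..<1}" "u \<in> {0<..<1}"
    and sup: "\<And>n i. n \<ge> k \<Longrightarrow> i \<in> {1..n} \<Longrightarrow> (SUP \<theta>\<in>{0..l}. P n i \<theta> - \<kappa> n i) \<le> e"
      "\<And>n i. n \<ge> k \<Longrightarrow> i \<in> {1..n} \<Longrightarrow> (SUP \<theta>\<in>{u..1}. \<gamma> n i - P n i \<theta>) \<le> e"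
    using ex assms by meson
  have low: "P n i x - \<kappa> n i \<in> {0..e}" if "n \<ge> k" "i \<in> {1..n}" "x \<in> {0..l}" for n i x
  proof -
    \<comment> \<open>A real supremum dominates the individual values only for a set that is bounded
      above.\<close>
    have "bdd_above ((\<lambda>\<theta>. P n i \<theta> - \<kappa> n i) ` {0..l})"
      using range[OF that(1,2)] lu by (intro bdd_aboveI[of _ "\<gamma> n i - \<kappa> n i"]) auto
    then show ?thesis
      using cSUP_upper[of x "{0..l}" "\<lambda>\<theta>. P n i \<theta> - \<kappa> n i"] sup(1)[OF that(1,2)] that
        range[OF that(1,2), of x] lu by auto
  qed
  have high: "\<gamma> n i - P n i x \<in> {0..e}" if "n \<ge> k" "i \<in> {1..n}" "x \<in> {u..1}" for n i x
  proof -
    have "bdd_above ((\<lambda>\<theta>. \<gamma> n i - P n i \<theta>) ` {u..1})"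
      using range[OF that(1,2)] lu by (intro bdd_aboveI[of _ "\<gamma> n i - \<kappa> n i"]) auto
    then show ?thesis
      using cSUP_upper[of x "{u..1}" "\<lambda>\<theta>. \<gamma> n i - P n i \<theta>"] sup(2)[OF that(1,2)] that
        range[OF that(1,2), of x] lu by auto
  qed
  have "\<bar>P n i x - P n i y\<bar> \<le> e" if "n \<ge> k" "i \<in> {1..n}" "x \<in> {0..l}" "y \<in> {0..l}" for n i x y
    using low[OF that(1,2,3)] low[OF that(1,2,4)] by auto
  moreover have "\<bar>P n i x - P n i y\<bar> \<le> e" if "n \<ge> k" "i \<in> {1..n}" "x \<in> {u..1}" "y \<in> {u..1}" for n i x y
    using high[OF that(1,2,3)] high[OF that(1,2,4)] by auto
  ultimately show ?thesis
    by (intro bexI[OF _ lu(1)] bexI[OF _ lu(2)] allI impI ballI conjI)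
qed

end

subsection \<open>Two arrays with the same mixed moments\<close>

text \<open>The link between the arrays is \<open>moments\<close>: products over distinct indices
  have equal integrals, being the same manifest probability.\<close>

locale irf_array_pair = irf_array k P + Q: irf_array k Q for k P Q +
  assumes moments: "n \<ge> k \<Longrightarrow> I \<subseteq> {1..n} \<Longrightarrow>
    (\<integral>\<theta>. (\<Prod>i\<in>I. P n i \<theta>) \<partial>unit_space) = (\<integral>\<theta>. (\<Prod>i\<in>I. Q n i \<theta>) \<partial>unit_space)"
begin

lemma swap: "irf_array_pair k Q P"
  using moments by unfold_locales simp

section \<open>Discrepancies of test functions of the score\<close>

definition discrepancy :: "nat \<Rightarrow> nat set \<Rightarrow> (real \<Rightarrow> real) \<Rightarrow> real" where
  "discrepancy n I f =
    (\<integral>\<theta>. (\<Prod>i\<in>I. P n i \<theta>) * f (test_score P n \<theta>) \<partial>unit_space) -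
    (\<integral>\<theta>. (\<Prod>i\<in>I. Q n i \<theta>) * f (test_score Q n \<theta>) \<partial>unit_space)"

text \<open>Two kinds of index set are needed: the empty set compares the laws of the two scores, a
  singleton brings in one response function. The restriction to \<open>card I \<le> 1\<close> makes
  the bound uniform in \<open>I\<close>.\<close>

lemma discrepancy_power:
  assumes "n \<ge> k" "I \<subseteq> {1..n}" "card I \<le> 1"
  shows "\<bar>discrepancy n I (\<lambda>x. x ^ d)\<bar> \<le> real (d * (1 + d)) / n"
proof -
  have "\<bar>discrepancy n I (\<lambda>x. x ^ d)\<bar> \<le> real (d * (card I + d)) / card {1..n}"
    unfolding discrepancy_def test_score_def card_atLeastAtMost diff_Suc_1
    using assms k_pos irf_measurable Q.irf_measurable irf_unit Q.irf_unit moments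
    by (intro unit_space.moment_average_diff[of "{1..n}", unfolded card_atLeastAtMost diff_Suc_1]) auto
  also have "\<dots> \<le> real (d * (1 + d)) / card {1..n}"
  proof -
    have "d * (card I + d) \<le> d * (1 + d)"
      using assms(3) by (intro mult_left_mono) simp_all
    then show ?thesis
      by (intro divide_right_mono of_nat_mono) simp_all
  qed
  finally show ?thesis by simp
qed

text \<open>Linearity of the integral, stated for an arbitrary array \<open>R\<close> so that it can
  be used for both \<open>P\<close> and \<open>Q\<close>.\<close>

lemma integral_polynomial:
  assumes "irf_array k R" "n \<ge> k" "I \<subseteq> {1..n}"
  shows "(\<integral>\<theta>. (\<Prod>i\<in>I. R n i \<theta>) * (\<Sum>j\<le>m. a j * test_score R n \<theta> ^ j) \<partial>unit_space) =
    (\<Sum>j\<le>m. a j * (\<integral>\<theta>. (\<Prod>i\<in>I. R n i \<theta>) * test_score R n \<theta> ^ j \<partial>unit_space))"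
proof -
  have int: "integrable unit_space (\<lambda>\<theta>. (\<Prod>i\<in>I. R n i \<theta>) * test_score R n \<theta> ^ j)" for j
    using irf_array.integrable_prod_test_score[OF assms, of "\<lambda>x. x ^ j"]
    by (simp add: continuous_on_power continuous_on_id)
  have "(\<integral>\<theta>. (\<Prod>i\<in>I. R n i \<theta>) * (\<Sum>j\<le>m. a j * test_score R n \<theta> ^ j) \<partial>unit_space) =
      (\<integral>\<theta>. (\<Sum>j\<le>m. a j * ((\<Prod>i\<in>I. R n i \<theta>) * test_score R n \<theta> ^ j)) \<partial>unit_space)"
    by (simp only: sum_distrib_left mult.left_commute)
  also have "\<dots> = (\<Sum>j\<le>m. \<integral>\<theta>. a j * ((\<Prod>i\<in>I. R n i \<theta>) * test_score R n \<theta> ^ j) \<partial>unit_space)"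
    using int by (intro Bochner_Integration.integral_sum) simp
  also have "\<dots> = (\<Sum>j\<le>m. a j * (\<integral>\<theta>. (\<Prod>i\<in>I. R n i \<theta>) * test_score R n \<theta> ^ j \<partial>unit_space))"
    by (simp only: integral_mult_right_zero)
  finally show ?thesis .
qed

lemma discrepancy_polynomial:
  assumes "e > 0"
  shows "\<forall>\<^sub>F n in sequentially. \<forall>I\<subseteq>{1..n}. card I \<le> 1 \<longrightarrow>
    \<bar>discrepancy n I (\<lambda>x. \<Sum>j\<le>m. a j * x ^ j)\<bar> \<le> e"
proof -
  \<comment> \<open>The moment errors weighted by the coefficients, without the factor
    \<open>1 / n\<close>; independent of \<open>n\<close> and \<open>I\<close>.\<close>
  define C where "C = (\<Sum>j\<le>m. \<bar>a j\<bar> * real (j * (1 + j)))"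
  have "(\<lambda>n. C / real n) \<longlonglongrightarrow> 0"
    by (rule lim_const_over_n)
  then have ev: "\<forall>\<^sub>F n in sequentially. C / real n < e"
    using assms by (rule order_tendstoD)
  have bound: "\<bar>discrepancy n I (\<lambda>x. \<Sum>j\<le>m. a j * x ^ j)\<bar> \<le> C / n"
    if "n \<ge> k" "I \<subseteq> {1..n}" "card I \<le> 1" for n I
  proof -
    have "discrepancy n I (\<lambda>x. \<Sum>j\<le>m. a j * x ^ j) = (\<Sum>j\<le>m. a j * discrepancy n I (\<lambda>x. x ^ j))"
      unfolding discrepancy_def integral_polynomial[OF irf_array_axioms that(1,2)]
        integral_polynomial[OF Q.irf_array_axioms that(1,2)]
      by (simp only: right_diff_distrib sum_subtractf)
    also have "\<bar>\<dots>\<bar> \<le> (\<Sum>j\<le>m. \<bar>a j * discrepancy n I (\<lambda>x. x ^ j)\<bar>)"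
      by (rule sum_abs)
    also have "\<dots> \<le> (\<Sum>j\<le>m. \<bar>a j\<bar> * (real (j * (1 + j)) / n))"
      unfolding abs_mult using discrepancy_power[OF that] by (intro sum_mono mult_left_mono) auto
    also have "\<dots> = C / n"
      by (simp only: C_def sum_divide_distrib times_divide_eq_right)
    finally show ?thesis .
  qed
  show ?thesis
    using ev eventually_ge_at_top[of k]
  proof eventually_elim
    case (elim n)
    show ?case
    proof (intro allI impI)
      fix I assume "I \<subseteq> {1..n}" "card I \<le> 1"
      with elim(2) have "\<bar>discrepancy n I (\<lambda>x. \<Sum>j\<le>m. a j * x ^ j)\<bar> \<le> C / n"
        by (rule bound)
      with elim(1) show "\<bar>discrepancy n I (\<lambda>x. \<Sum>j\<le>m. a j * x ^ j)\<bar> \<le> e"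
        by linarith
    qed
  qed
qed

lemma discrepancy_close:
  assumes "n \<ge> k" "I \<subseteq> {1..n}"
    and "continuous_on UNIV f" "continuous_on UNIV g" "\<And>x. x \<in> {0..1} \<Longrightarrow> \<bar>f x - g x\<bar> \<le> e"
  shows "\<bar>discrepancy n I f - discrepancy n I g\<bar> \<le> 2 * e"
  using integral_prod_test_score_close[OF assms] Q.integral_prod_test_score_close[OF assms]
  unfolding discrepancy_def by linarith

lemma discrepancy_continuous:
  assumes f: "continuous_on UNIV f" and e: "e > 0"
  shows "\<forall>\<^sub>F n in sequentially. \<forall>I\<subseteq>{1..n}. card I \<le> 1 \<longrightarrow> \<bar>discrepancy n I f\<bar> \<le> e"
proof -
  \<comment> \<open>Scores lie in \<open>{0..1}\<close>, so approximation there suffices. An error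
    of \<open>e / 4\<close> changes each of the two integrals by at most that much, hence the
    discrepancy by \<open>e / 2\<close>.\<close>
  obtain g where "real_polynomial_function g" and fg: "\<And>x. x \<in> {0..1} \<Longrightarrow> \<bar>f x - g x\<bar> < e / 4"
    using Stone_Weierstrass_real_polynomial_function[of "{0..1}" f "e / 4"] f e
      continuous_on_subset[OF f, of "{0..1}"] by auto
  then obtain a m where g: "g = (\<lambda>x. \<Sum>j\<le>m. a j * x ^ j)"
    using real_polynomial_function_iff_sum by blast
  have cont: "continuous_on UNIV g"
    unfolding g by (intro continuous_intros)
  have ev: "\<forall>\<^sub>F n in sequentially. \<forall>I\<subseteq>{1..n}. card I \<le> 1 \<longrightarrow> \<bar>discrepancy n I g\<bar> \<le> e / 2"
    unfolding g using e by (intro discrepancy_polynomial) simp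
  have close: "\<bar>discrepancy n I f - discrepancy n I g\<bar> \<le> e / 2" if "n \<ge> k" "I \<subseteq> {1..n}" for n I
    using discrepancy_close[OF that f cont, of "e / 4"] fg by (simp add: less_imp_le)
  show ?thesis
    using ev eventually_ge_at_top[of k]
  proof eventually_elim
    case (elim n)
    show ?case
    proof (intro allI impI)
      fix I assume I: "I \<subseteq> {1..n}" "card I \<le> 1"
      with elim close[of n I] have "\<bar>discrepancy n I g\<bar> \<le> e / 2" "\<bar>discrepancy n I f - discrepancy n I g\<bar> \<le> e / 2"
        by auto
      then show "\<bar>discrepancy n I f\<bar> \<le> e"
        by linarith
    qed
  qed
qed

text \<open>Uniformity in the shift \<open>c\<close> comes from a finite grid of shifts, since \<open>h\<close> is 1-Lipschitz.\<close>

lemma discrepancy_shift: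
  assumes h: "\<And>x y :: real. \<bar>h x - h y\<bar> \<le> \<bar>x - y\<bar>" and e: "e > 0"
  shows "\<forall>\<^sub>F n in sequentially. \<forall>c\<in>{0..1}. \<forall>I\<subseteq>{1..n}. card I \<le> 1 \<longrightarrow>
    \<bar>discrepancy n I (\<lambda>x. h (x - c))\<bar> \<le> e"
proof -
  have "1-lipschitz_on UNIV h"
    using h by (intro lipschitz_onI) (auto simp: dist_real_def)
  then have h_cont: "continuous_on UNIV h"
    by (rule lipschitz_on_continuous_on)
  have cont: "continuous_on UNIV (\<lambda>x. h (x - c))" for c
    by (rule continuous_on_compose2[OF h_cont]) (auto intro!: continuous_intros)
  \<comment> \<open>The grid consists of the points \<open>j / N\<close> with
    \<open>j \<le> N\<close>. Moving the shift by at most \<open>1 / N\<close> changes the test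
    function by at most \<open>e / 4\<close> and the discrepancy by at most
    \<open>e / 2\<close>.\<close>
  obtain N :: nat where N: "4 / e < N"
    using reals_Archimedean2 by blast
  then have N_pos: "0 < real N"
    using e by (meson divide_pos_pos less_trans zero_less_numeral)
  have "\<forall>\<^sub>F n in sequentially. \<forall>j\<in>{..N}. \<forall>I\<subseteq>{1..n}. card I \<le> 1 \<longrightarrow>
      \<bar>discrepancy n I (\<lambda>x. h (x - real j / N))\<bar> \<le> e / 2"
    using discrepancy_continuous[OF cont, of "e / 2"] e by (intro eventually_ball_finite) auto
  then show ?thesis
    using eventually_ge_at_top[of k]
  proof eventually_elim
    case (elim n)
    show ?case
    proof (intro ballI allI impI)
      fix c :: real and I assume c: "c \<in> {0..1}" and I: "I \<subseteq> {1..n}" "card I \<le> 1"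
      define j where "j = nat \<lfloor>c * N\<rfloor>"
      have j: "real j \<le> c * N" "c * N \<le> real j + 1"
        using c by (auto simp: j_def)
      moreover have "c * real N \<le> 1 * real N"
        using c by (intro mult_right_mono) auto
      ultimately have "j \<in> {..N}" by simp
      then have grid: "\<bar>discrepancy n I (\<lambda>x. h (x - real j / N))\<bar> \<le> e / 2"
        using elim(1) I by blast
      have "\<bar>c - real j / N\<bar> \<le> 1 / N"
        using j N_pos by (simp add: abs_le_iff divide_le_eq le_divide_eq left_diff_distrib)
      also have "\<dots> \<le> e / 4"
        using N e N_pos by (simp add: divide_le_eq le_divide_eq pos_divide_less_eq mult.commute)
      finally have "\<bar>h (x - c) - h (x - real j / N)\<bar> \<le> e / 4" for x
        using h[of "x - c" "x - real j / N"] by linarith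
      then have "\<bar>discrepancy n I (\<lambda>x. h (x - c)) - discrepancy n I (\<lambda>x. h (x - real j / N))\<bar> \<le> 2 * (e / 4)"
        using elim(2) I by (intro discrepancy_close cont)
      with grid show "\<bar>discrepancy n I (\<lambda>x. h (x - c))\<bar> \<le> e"
        by linarith
    qed
  qed
qed

section \<open>Convergence of the scores\<close>

text \<open>The probability that the score is small would otherwise differ between the two models.\<close>

lemma test_score_upper:
  assumes \<theta>: "\<theta> \<in> {0<..<1}" and e: "e > 0"
  shows "\<forall>\<^sub>F n in sequentially. test_score P n \<theta> < test_score Q n \<theta> + e"
proof -
  obtain K where K: "K > 0" and incr: "\<forall>n\<ge>k. \<forall>i\<in>{1..n}. \<forall>x y. \<theta> / 2 \<le> x \<and> x \<le> y \<and> y \<le> \<theta> \<longrightarrow>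
      P n i y - P n i x \<le> K * (y - x)"
    using increment_bounds[of "\<theta> / 2" \<theta>] \<theta> by auto
  \<comment> \<open>Moving left from \<open>\<theta>\<close> by \<open>\<delta>\<close> stays where
    the slope bound \<open>K\<close> is valid and lowers the score of \<open>P\<close> by at most
    \<open>e / 4\<close>.\<close>
  define \<delta> where "\<delta> = min (\<theta> / 2) (e / (4 * K))"
  have \<delta>: "0 < \<delta>" "\<delta> \<le> \<theta> / 2" "K * \<delta> \<le> e / 4"
    using \<theta> e K by (auto simp: \<delta>_def min_def field_simps)
  define s where "s = e / 4"
  \<comment> \<open>A continuous substitute for \<open>s\<close> times the indicator of
    \<open>x \<le> 0\<close>, falling to 0 on the interval from 0 to \<open>s\<close>.\<close>
  define h where "h = (\<lambda>x. max 0 (min s (s - x)))"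
  have s: "s > 0" using e by (simp add: s_def)
  have h_lip: "\<bar>h x - h y\<bar> \<le> \<bar>x - y\<bar>" for x y
    unfolding h_def by (rule ramp_lipschitz)
  have h_cont: "continuous_on UNIV (\<lambda>x. h (x - c))" for c
    unfolding h_def by (intro continuous_intros)
  have h: "0 \<le> h x" "h x \<le> s" "x \<le> 0 \<Longrightarrow> h x = s" "s \<le> x \<Longrightarrow> h x = 0" for x
    using s by (auto simp: h_def)
  \<comment> \<open>A gap of \<open>e\<close> at \<open>\<theta>\<close> would force a discrepancy
    of at most \<open>- s * \<delta>\<close>; half of that size is enough for a
    contradiction.\<close>
  have small: "\<forall>\<^sub>F n in sequentially. \<forall>c\<in>{0..1}. \<forall>I\<subseteq>{1..n}. card I \<le> 1 \<longrightarrow>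
      \<bar>discrepancy n I (\<lambda>x. h (x - c))\<bar> \<le> s * \<delta> / 2"
    using h_lip s \<delta> by (intro discrepancy_shift) auto
  show ?thesis
    using small eventually_ge_at_top[of k]
  proof eventually_elim
    case (elim n)
    note n = elim(2)
    define c where "c = test_score Q n \<theta>"
    show ?case
    proof (rule ccontr)
      assume "\<not> ?case"
      then have gap: "c + e \<le> test_score P n \<theta>"
        by (simp add: c_def)
      have "test_score P n \<theta> - test_score P n (\<theta> - \<delta>) \<le> K * (\<theta> - (\<theta> - \<delta>))"
      proof (rule test_score_increment_le[OF n])
        fix i assume i: "i \<in> {1..n}"
        have "\<theta> / 2 \<le> \<theta> - \<delta> \<and> \<theta> - \<delta> \<le> \<theta> \<and> \<theta> \<le> \<theta>"
          using \<delta> by simp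
        with incr n i show "P n i \<theta> - P n i (\<theta> - \<delta>) \<le> K * (\<theta> - (\<theta> - \<delta>))"
          by blast
      qed
      \<comment> \<open>So the ramp vanishes for \<open>P\<close> from
        \<open>\<theta> - \<delta>\<close> onwards, whereas for \<open>Q\<close> it has full height
        \<open>s\<close> up to \<open>\<theta>\<close>.\<close>
      then have shifted: "c + s \<le> test_score P n (\<theta> - \<delta>)"
        using gap \<delta>(3) e by (simp add: s_def)
      have int: "integrable unit_space (\<lambda>x. h (test_score P n x - c))"
        "integrable unit_space (\<lambda>x. h (test_score Q n x - c))"
        using integrable_prod_test_score[OF n, of "{}", OF _ h_cont]
          Q.integrable_prod_test_score[OF n, of "{}", OF _ h_cont] by simp_all
      have P_small: "(\<integral>x. h (test_score P n x - c) \<partial>unit_space) \<le> (\<integral>x. s * indicator {0<..<\<theta> - \<delta>} x \<partial>unit_space)"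
      proof (rule integral_mono[OF int(1)])
        show "h (test_score P n x - c) \<le> s * indicator {0<..<\<theta> - \<delta>} x" if "x \<in> space unit_space" for x
        proof (cases "x < \<theta> - \<delta>")
          case False
          then have "test_score P n (\<theta> - \<delta>) \<le> test_score P n x"
            using that \<delta> \<theta> by (intro test_score_mono[OF n]) auto
          then show ?thesis
            using shifted h(4) s by (simp add: indicator_def)
        qed (use that h(2) in simp)
      qed (use integral_unit_space_indicator(1) \<delta> \<theta> in auto)
      have Q_large: "(\<integral>x. s * indicator {0<..<\<theta>} x \<partial>unit_space) \<le> (\<integral>x. h (test_score Q n x - c) \<partial>unit_space)"
      proof (rule integral_mono[OF _ int(2)])
        show "s * indicator {0<..<\<theta>} x \<le> h (test_score Q n x - c)" if "x \<in> space unit_space" for x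
        proof (cases "x < \<theta>")
          case True
          then have "test_score Q n x \<le> c"
            unfolding c_def using that \<theta> by (intro Q.test_score_mono[OF n]) auto
          then show ?thesis
            using h(3) s by (simp add: indicator_def)
        qed (use h(1) in simp)
      qed (use integral_unit_space_indicator(1) \<theta> in auto)
      have "discrepancy n {} (\<lambda>x. h (x - c)) \<le> s * (\<theta> - \<delta>) - s * \<theta>"
      proof -
        have "(\<integral>x. s * indicator {0<..<\<theta>} x \<partial>unit_space) = s * \<theta>"
          "(\<integral>x. s * indicator {0<..<\<theta> - \<delta>} x \<partial>unit_space) = s * (\<theta> - \<delta>)"
          using \<theta> \<delta> integral_unit_space_indicator(2)[of 0 \<theta> s] integral_unit_space_indicator(2)[of 0 "\<theta> - \<delta>" s] by auto
        moreover have "discrepancy n {} (\<lambda>x. h (x - c)) =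
            (\<integral>x. h (test_score P n x - c) \<partial>unit_space) - (\<integral>x. h (test_score Q n x - c) \<partial>unit_space)"
          by (simp add: discrepancy_def)
        ultimately show ?thesis
          using P_small Q_large by linarith
      qed
      moreover have "c \<in> {0..1}"
        unfolding c_def using \<theta> by (intro Q.test_score_unit[OF n]) auto
      then have "\<bar>discrepancy n {} (\<lambda>x. h (x - c))\<bar> \<le> s * \<delta> / 2"
        using elim(1) by simp
      moreover have "s * (\<theta> - \<delta>) - s * \<theta> = - (s * \<delta>)" "0 < s * \<delta>"
        using s \<delta> by (simp_all add: right_diff_distrib)
      ultimately show False
        by linarith
    qed
  qed
qed

lemma test_score_tendsto:
  assumes "\<theta> \<in> {0<..<1}"
  shows "(\<lambda>n. \<bar>test_score P n \<theta> - test_score Q n \<theta>\<bar>) \<longlonglongrightarrow> 0"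
proof (rule tendstoI)
  interpret swapped: irf_array_pair k Q P
    by (rule swap)
  fix e :: real assume "e > 0"
  from test_score_upper[OF assms this] swapped.test_score_upper[OF assms this]
  show "\<forall>\<^sub>F n in sequentially. dist \<bar>test_score P n \<theta> - test_score Q n \<theta>\<bar> 0 < e"
    by eventually_elim (simp add: dist_real_def abs_less_iff)
qed

text \<open>Pointwise convergence of scores in \<open>{0..1}\<close>, integrated by dominated
  convergence. The mean distance bounds the cost of exchanging one score for the other inside a
  1-Lipschitz function.\<close>

lemma test_score_L1_tendsto:
  "(\<lambda>n. \<integral>\<theta>. \<bar>test_score P n \<theta> - test_score Q n \<theta>\<bar> \<partial>unit_space) \<longlonglongrightarrow> 0"
\<comment> \<open>Shifting by \<open>k\<close> lets measurability and the bound by 1 hold for every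
  index.\<close>
proof (rule LIMSEQ_offset[of _ k])
  have "(\<lambda>n. \<integral>\<theta>. \<bar>test_score P (n + k) \<theta> - test_score Q (n + k) \<theta>\<bar> \<partial>unit_space)
      \<longlonglongrightarrow> (\<integral>\<theta>. 0 \<partial>unit_space)"
  proof (rule integral_dominated_convergence[where w = "\<lambda>_. 1"])
    show "(\<lambda>\<theta>. \<bar>test_score P (n + k) \<theta> - test_score Q (n + k) \<theta>\<bar>) \<in> borel_measurable unit_space" for n
      using test_score_measurable[of "n + k"] Q.test_score_measurable[of "n + k"] by measurable
    show "AE \<theta> in unit_space. (\<lambda>n. \<bar>test_score P (n + k) \<theta> - test_score Q (n + k) \<theta>\<bar>) \<longlonglongrightarrow> 0"
      using LIMSEQ_ignore_initial_segment[OF test_score_tendsto] by (intro AE_I2) simp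
    have "\<bar>test_score P (n + k) \<theta> - test_score Q (n + k) \<theta>\<bar> \<le> 1" if "\<theta> \<in> {0<..<1}" for n \<theta>
      using test_score_unit[of "n + k" \<theta>] Q.test_score_unit[of "n + k" \<theta>] that by auto
    then show "AE \<theta> in unit_space. norm \<bar>test_score P (n + k) \<theta> - test_score Q (n + k) \<theta>\<bar> \<le> 1" for n
      by (intro AE_I2) simp
  qed auto
  then show "(\<lambda>n. \<integral>\<theta>. \<bar>test_score P (n + k) \<theta> - test_score Q (n + k) \<theta>\<bar> \<partial>unit_space) \<longlonglongrightarrow> 0"
    by simp
qed

section \<open>Local uniform convergence of the response functions\<close>

text \<open>A tent function of the score localises at \<open>\<theta>\<close>, up to an interval on which \<open>P n i - Q n i\<close>
  keeps its sign.\<close>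

lemma irf_upper:
  assumes lu: "0 < l" "l < u" "u < 1" and e: "e > 0"
  shows "\<forall>\<^sub>F n in sequentially. \<forall>i\<in>{1..n}. \<forall>\<theta>\<in>{l..u}. P n i \<theta> < Q n i \<theta> + e"
proof -
  \<comment> \<open>Room to the right of \<open>u\<close>: the interval from \<open>\<theta>\<close>
    to \<open>\<theta> + \<delta>\<close> must stay inside the region of uniform slope
    bounds.\<close>
  define v where "v = (1 + u) / 2"
  have v: "l < v" "u < v" "v < 1"
    using lu by (auto simp: v_def)
  obtain m K where m: "m > 0" and K: "K > 0"
    and P_incr: "\<forall>n\<ge>k. \<forall>i\<in>{1..n}. \<forall>x y. l \<le> x \<and> x \<le> y \<and> y \<le> v \<longrightarrow>
      m * (y - x) \<le> P n i y - P n i x \<and> P n i y - P n i x \<le> K * (y - x)"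
    using increment_bounds[OF lu(1) v(1,3)] by blast
  have P_ge: "m * (y - x) \<le> P n i y - P n i x" and P_le: "P n i y - P n i x \<le> K * (y - x)"
    if "n \<ge> k" "l \<le> x" "x \<le> y" "y \<le> v" "i \<in> {1..n}" for n i x y
    using P_incr that by blast+
  obtain K' where K': "K' > 0"
    and Q_incr: "\<forall>n\<ge>k. \<forall>i\<in>{1..n}. \<forall>x y. l \<le> x \<and> x \<le> y \<and> y \<le> v \<longrightarrow>
      Q n i y - Q n i x \<le> K' * (y - x)"
    using Q.increment_bounds[OF lu(1) v(1,3)] by blast
  have Q_le: "Q n i y - Q n i x \<le> K' * (y - x)"
    if "n \<ge> k" "l \<le> x" "x \<le> y" "y \<le> v" "i \<in> {1..n}" for n i x y
    using Q_incr that by blast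
  \<comment> \<open>Since \<open>P n i\<close> increases and \<open>Q n i\<close> grows by at most
    \<open>K' * \<delta>\<close>, a gap of \<open>e\<close> at \<open>\<theta>\<close> remains at
    least \<open>e / 2\<close> up to \<open>\<theta> + \<delta>\<close>.\<close>
  define \<delta> where "\<delta> = min (v - u) (e / (2 * K'))"
  have \<delta>: "0 < \<delta>" "u + \<delta> \<le> v" "K' * \<delta> \<le> e / 2"
    using v e K' by (auto simp: \<delta>_def min_def field_simps)
  \<comment> \<open>The score of \<open>P\<close> moves by at least \<open>r\<close> from the
    midpoint to either end of that interval, so a tent of half-width \<open>r\<close> vanishes
    outside it.\<close>
  define r where "r = m * (\<delta> / 2)"
  \<comment> \<open>Within distance \<open>w\<close> of the midpoint the score moves by at most
    \<open>r / 2\<close>, so the tent keeps at least half its height.\<close>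
  define w where "w = min (\<delta> / 2) (r / (2 * K))"
  have r: "r > 0"
    using m \<delta> by (simp add: r_def)
  then have w: "0 < w" "w \<le> \<delta> / 2" "K * w \<le> r / 2"
    using \<delta> K by (auto simp: w_def min_def field_simps)
  define h where "h = (\<lambda>x. max 0 (r - \<bar>x\<bar>))"
  have h_lip: "\<bar>h x - h y\<bar> \<le> \<bar>x - y\<bar>" for x y
    unfolding h_def by (rule tent_lipschitz)
  have h_cont: "continuous_on UNIV (\<lambda>x. h (x - c))" for c
    unfolding h_def by (intro continuous_intros)
  have h_meas [measurable]: "h \<in> borel_measurable borel"
    unfolding h_def by measurable
  have h: "0 \<le> h x" "h x \<le> r" "r \<le> \<bar>x\<bar> \<Longrightarrow> h x = 0" "\<bar>x\<bar> \<le> r / 2 \<Longrightarrow> r / 2 \<le> h x" for x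
    using r by (auto simp: h_def)
  \<comment> \<open>Remaining gap times tent height times window length. The discrepancy and the
    distance of the scores, each at most \<open>C / 3\<close>, cannot add up to it.\<close>
  define C where "C = e / 2 * (r / 2) * (2 * w)"
  have C: "C > 0" using e r w by (simp add: C_def)
  have small: "\<forall>\<^sub>F n in sequentially. \<forall>c\<in>{0..1}. \<forall>I\<subseteq>{1..n}. card I \<le> 1 \<longrightarrow>
      \<bar>discrepancy n I (\<lambda>x. h (x - c))\<bar> \<le> C / 3"
    using h_lip C by (intro discrepancy_shift) auto
  have close: "\<forall>\<^sub>F n in sequentially. (\<integral>\<theta>. \<bar>test_score P n \<theta> - test_score Q n \<theta>\<bar> \<partial>unit_space) < C / 3"
    using test_score_L1_tendsto C by (intro order_tendstoD) auto
  show ?thesis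
    using small close eventually_ge_at_top[of k]
  proof eventually_elim
    case (elim n)
    note n = elim(3)
    show ?case
    proof (intro ballI, rule ccontr)
      fix i \<theta> assume i: "i \<in> {1..n}" and \<theta>: "\<theta> \<in> {l..u}" and "\<not> P n i \<theta> < Q n i \<theta> + e"
      then have gap: "Q n i \<theta> + e \<le> P n i \<theta>" by simp
      define t where "t = \<theta> + \<delta> / 2"
      define c where "c = test_score P n t"
      have t: "l \<le> \<theta>" "\<theta> < t" "t < \<theta> + \<delta>" "\<theta> + \<delta> \<le> v" "\<theta> \<le> t - w" "t + w \<le> \<theta> + \<delta>"
        using \<theta> \<delta> w by (auto simp: t_def)
      have c_unit: "c \<in> {0..1}"
        unfolding c_def using t lu v by (intro test_score_unit[OF n]) auto
      note P_meas [measurable] = irf_measurable[OF n i] and Q_meas [measurable] = Q.irf_measurable[OF n i]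
        and SP_meas [measurable] = test_score_measurable[OF n] and SQ_meas [measurable] = Q.test_score_measurable[OF n]
      let ?g = "\<lambda>x. h (test_score P n x - c)"
      let ?g' = "\<lambda>x. h (test_score Q n x - c)"
      \<comment> \<open>Three regions: the window around \<open>t\<close>, where gap and tent are
        both bounded below; the rest of the interval, where the product is nonnegative; the outside,
        where the tent is 0.\<close>
      have lower: "e / 2 * (r / 2) * indicator {t - w<..<t + w} x \<le> (P n i x - Q n i x) * ?g x"
        if x: "x \<in> {0<..<1}" for x
      proof (cases "x \<in> {\<theta>..\<theta> + \<delta>}")
        case True
        have "Q n i x - Q n i \<theta> \<le> K' * (x - \<theta>)"
          using True t by (intro Q_le[OF n _ _ _ i]) auto
        also have "\<dots> \<le> K' * \<delta>"
          using True K' by (intro mult_left_mono) auto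
        also have "P n i \<theta> \<le> P n i x"
          using True x t lu by (intro irf_mono[OF n i]) auto
        ultimately have diff: "e / 2 \<le> P n i x - Q n i x"
          using gap \<delta>(3) by linarith
        show ?thesis
        proof (cases "x \<in> {t - w<..<t + w}")
          case inner: True
          have "\<bar>test_score P n x - c\<bar> \<le> K * \<bar>x - t\<bar>"
          proof (cases "x \<le> t")
            case x_le: True
            have "test_score P n t - test_score P n x \<le> K * (t - x)"
              using x_le True t by (intro test_score_increment_le[OF n] P_le[OF n]) auto
            moreover have "test_score P n x \<le> test_score P n t"
              using x_le x t v by (intro test_score_mono[OF n]) auto
            ultimately show ?thesis
              using x_le by (simp add: c_def)
          next
            case False
            have "test_score P n x - test_score P n t \<le> K * (x - t)"
              using False True t by (intro test_score_increment_le[OF n] P_le[OF n]) auto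
            moreover have "test_score P n t \<le> test_score P n x"
              using False x t lu by (intro test_score_mono[OF n]) auto
            ultimately show ?thesis
              using False by (simp add: c_def)
          qed
          also have "\<dots> \<le> K * w"
            using inner K by (intro mult_left_mono) auto
          finally have "r / 2 \<le> ?g x"
            using w(3) by (intro h(4)) simp
          then have "e / 2 * (r / 2) \<le> (P n i x - Q n i x) * ?g x"
            using diff e r by (intro mult_mono) auto
          then show ?thesis
            using inner by simp
        next
          case False
          then show ?thesis
            using diff e h(1) by simp
        qed
      next
        case False
        have "r \<le> \<bar>test_score P n x - c\<bar>"
        proof (cases "x < \<theta>")
          case True
          have "m * (t - \<theta>) \<le> c - test_score P n \<theta>"
            unfolding c_def using t by (intro test_score_increment_ge[OF n] P_ge[OF n]) auto
          then have "r \<le> c - test_score P n \<theta>"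
            by (simp add: r_def t_def)
          moreover have "test_score P n x \<le> test_score P n \<theta>"
            using True x t v by (intro test_score_mono[OF n]) auto
          ultimately show ?thesis by linarith
        next
          case False
          have "m * (\<theta> + \<delta> - t) \<le> test_score P n (\<theta> + \<delta>) - c"
            unfolding c_def using t by (intro test_score_increment_ge[OF n] P_ge[OF n]) auto
          then have "r \<le> test_score P n (\<theta> + \<delta>) - c"
            by (simp add: r_def t_def)
          moreover have "test_score P n (\<theta> + \<delta>) \<le> test_score P n x"
            using False \<open>x \<notin> {\<theta>..\<theta> + \<delta>}\<close> x t lu by (intro test_score_mono[OF n]) auto
          ultimately show ?thesis by linarith
        qed
        moreover have "x \<notin> {t - w<..<t + w}"
          using False t by auto
        ultimately show ?thesis
          using h(3) by simp
      qed
      have P01: "P n i x \<in> {0..1}" and Q01: "Q n i x \<in> {0..1}" if "x \<in> {0<..<1}" for x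
        using irf_unit[OF n i] Q.irf_unit[OF n i] that by auto
      have window: "0 \<le> t - w" "t - w \<le> t + w" "t + w \<le> 1"
        using t w lu v by auto
      have int_P: "integrable unit_space (\<lambda>x. P n i x * ?g x)"
        using integrable_prod_test_score[OF n, of "{i}", OF _ h_cont] i by simp
      have int_Q': "integrable unit_space (\<lambda>x. Q n i x * ?g' x)"
        using Q.integrable_prod_test_score[OF n, of "{i}", OF _ h_cont] i by simp
      have "\<bar>Q n i x * ?g x\<bar> \<le> r" if "x \<in> {0<..<1}" for x
        using Q01[OF that] h(1,2)[of "test_score P n x - c"] mult_mono[of "Q n i x" 1 "?g x" r] by auto
      then have int_Q: "integrable unit_space (\<lambda>x. Q n i x * ?g x)"
        by (intro unit_space.integrable_const_bound[where B = r] AE_I2) auto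
      have "\<bar>test_score P n x - test_score Q n x\<bar> \<le> 1" if "x \<in> {0<..<1}" for x
        using test_score_unit[OF n, of x] Q.test_score_unit[OF n, of x] that by auto
      then have int_score: "integrable unit_space (\<lambda>x. \<bar>test_score P n x - test_score Q n x\<bar>)"
        by (intro unit_space.integrable_const_bound[where B = 1] AE_I2) auto
      have "C = (\<integral>x. e / 2 * (r / 2) * indicator {t - w<..<t + w} x \<partial>unit_space)"
        unfolding integral_unit_space_indicator(2)[OF window] by (simp add: C_def)
      also have "\<dots> \<le> (\<integral>x. P n i x * ?g x - Q n i x * ?g x \<partial>unit_space)"
        using lower
        by (intro integral_mono Bochner_Integration.integrable_diff integral_unit_space_indicator(1)[OF window]
            int_P int_Q) (simp only: space_unit_space left_diff_distrib)
      also have "\<dots> = (\<integral>x. P n i x * ?g x \<partial>unit_space) - (\<integral>x. Q n i x * ?g x \<partial>unit_space)"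
        using int_P int_Q by (rule Bochner_Integration.integral_diff)
      finally have "C \<le> (\<integral>x. P n i x * ?g x \<partial>unit_space) - (\<integral>x. Q n i x * ?g x \<partial>unit_space)" .
      \<comment> \<open>The lower bound has the score of \<open>P\<close> in both tents, while the
        discrepancy pairs \<open>Q n i\<close> with the score of \<open>Q\<close>. As
        \<open>h\<close> is 1-Lipschitz and \<open>Q n i\<close> is at most 1, the exchange costs at
        most the mean distance of the scores.\<close>
      moreover have "(\<integral>x. Q n i x * ?g' x \<partial>unit_space) - (\<integral>x. Q n i x * ?g x \<partial>unit_space)
          \<le> (\<integral>x. \<bar>test_score P n x - test_score Q n x\<bar> \<partial>unit_space)"
      proof -
        have "Q n i x * ?g' x - Q n i x * ?g x \<le> \<bar>test_score P n x - test_score Q n x\<bar>"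
          if "x \<in> {0<..<1}" for x
        proof -
          have "Q n i x * (?g' x - ?g x) \<le> \<bar>Q n i x\<bar> * \<bar>?g' x - ?g x\<bar>"
            by (metis abs_ge_self abs_mult)
          also have "\<dots> \<le> 1 * \<bar>test_score P n x - test_score Q n x\<bar>"
            using Q01[OF that] h_lip[of "test_score Q n x - c" "test_score P n x - c"]
            by (intro mult_mono) (auto simp: abs_minus_commute)
          finally show ?thesis by (simp add: right_diff_distrib)
        qed
        then have "(\<integral>x. Q n i x * ?g' x - Q n i x * ?g x \<partial>unit_space)
            \<le> (\<integral>x. \<bar>test_score P n x - test_score Q n x\<bar> \<partial>unit_space)"
          using int_Q int_Q' int_score
          by (intro integral_mono Bochner_Integration.integrable_diff) simp_all
        then show ?thesis
          using int_Q int_Q' by simp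
      qed
      moreover have "\<bar>discrepancy n {i} (\<lambda>x. h (x - c))\<bar> \<le> C / 3"
        using elim(1) c_unit i by simp
      moreover have "discrepancy n {i} (\<lambda>x. h (x - c)) =
          (\<integral>x. P n i x * ?g x \<partial>unit_space) - (\<integral>x. Q n i x * ?g' x \<partial>unit_space)"
        by (simp add: discrepancy_def)
      ultimately show False
        using elim(2) C by linarith
    qed
  qed
qed

section \<open>Extension to the whole open interval\<close>

lemma irf_uniformly_close:
  assumes e: "e > 0"
  shows "\<forall>\<^sub>F n in sequentially. \<forall>i\<in>{1..n}. \<forall>\<theta>\<in>{0<..<1}. \<bar>P n i \<theta> - Q n i \<theta>\<bar> \<le> e"
proof -
  interpret swapped: irf_array_pair k Q P
    by (rule swap)
  have e3: "e / 3 > 0" using e by simp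
  obtain l u where lu: "l \<in> {0<..<1}" "u \<in> {0<..<1}"
    and P_tail: "\<forall>n\<ge>k. \<forall>i\<in>{1..n}.
      (\<forall>x\<in>{0..l}. \<forall>y\<in>{0..l}. \<bar>P n i x - P n i y\<bar> \<le> e / 3) \<and>
      (\<forall>x\<in>{u..1}. \<forall>y\<in>{u..1}. \<bar>P n i x - P n i y\<bar> \<le> e / 3)"
    using irf_tails[OF e3] by blast
  obtain l' u' where lu': "l' \<in> {0<..<1}" "u' \<in> {0<..<1}"
    and Q_tail: "\<forall>n\<ge>k. \<forall>i\<in>{1..n}.
      (\<forall>x\<in>{0..l'}. \<forall>y\<in>{0..l'}. \<bar>Q n i x - Q n i y\<bar> \<le> e / 3) \<and>
      (\<forall>x\<in>{u'..1}. \<forall>y\<in>{u'..1}. \<bar>Q n i x - Q n i y\<bar> \<le> e / 3)"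
    using Q.irf_tails[OF e3] by blast
  \<comment> \<open>The caps \<open>1 / 3\<close> here and \<open>2 / 3\<close> below guarantee
    \<open>a < b\<close>.\<close>
  define a where "a = min (min l l') (1 / 3)"
  define b where "b = max (max u u') (2 / 3)"
  have ab: "0 < a" "a < b" "b < 1" "a \<le> l" "a \<le> l'" "u \<le> b" "u' \<le> b"
    using lu lu' by (auto simp: a_def b_def)
  show ?thesis
    using irf_upper[OF ab(1-3) e3] swapped.irf_upper[OF ab(1-3) e3] eventually_ge_at_top[of k]
  proof eventually_elim
    case (elim n)
    show ?case
    proof (intro ballI)
      fix i \<theta> assume i: "i \<in> {1..n}" and \<theta>: "\<theta> \<in> {0<..<1::real}"
      note tails = P_tail[rule_format, OF elim(3) i] Q_tail[rule_format, OF elim(3) i]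
      have mid: "\<bar>P n i x - Q n i x\<bar> \<le> e / 3" if "x \<in> {a..b}" for x
      proof -
        have "P n i x < Q n i x + e / 3" "Q n i x < P n i x + e / 3"
          using elim(1,2) i that by blast+
        then show ?thesis by linarith
      qed
      \<comment> \<open>The point of \<open>{a..b}\<close> nearest to \<open>\<theta>\<close>: if
        \<open>\<theta>\<close> lies outside, both points lie in a common tail of each array, so two
        tail errors and one interior error of \<open>e / 3\<close> suffice.\<close>
      obtain x where x: "x \<in> {a..b}" "\<bar>P n i \<theta> - P n i x\<bar> \<le> e / 3" "\<bar>Q n i \<theta> - Q n i x\<bar> \<le> e / 3"
      proof (cases "\<theta> < a")
        case True
        then have "\<theta> \<in> {0..l}" "\<theta> \<in> {0..l'}" "a \<in> {0..l}" "a \<in> {0..l'}"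
          using \<theta> ab by auto
        then show thesis
          using that[of a] tails ab by simp
      next
        case not_low: False
        show thesis
        proof (cases "\<theta> > b")
          case True
          then have "\<theta> \<in> {u..1}" "\<theta> \<in> {u'..1}" "b \<in> {u..1}" "b \<in> {u'..1}"
            using \<theta> ab by auto
          then show thesis
            using that[of b] tails ab by simp
        next
          case False
          then show thesis
            using that[of \<theta>] not_low e by simp
        qed
      qed
      then show "\<bar>P n i \<theta> - Q n i \<theta>\<bar> \<le> e"
        using mid[OF x(1)] by linarith
    qed
  qed
qed

theorem max_sup_tendsto:
  "(\<lambda>n. MAX i\<in>{1..n}. SUP \<theta>\<in>{0<..<1}. \<bar>P n i \<theta> - Q n i \<theta>\<bar>) \<longlonglongrightarrow> 0"
proof (rule tendstoI)
  fix e :: real assume "e > 0"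
  \<comment> \<open>A supremum inherits only a weak inequality; halving makes it strict.\<close>
  then have "e / 2 > 0" by simp
  then have "\<forall>\<^sub>F n in sequentially. \<forall>i\<in>{1..n}. \<forall>\<theta>\<in>{0<..<1}. \<bar>P n i \<theta> - Q n i \<theta>\<bar> \<le> e / 2"
    by (rule irf_uniformly_close)
  then show "\<forall>\<^sub>F n in sequentially. dist (MAX i\<in>{1..n}. SUP \<theta>\<in>{0<..<1}. \<bar>P n i \<theta> - Q n i \<theta>\<bar>) 0 < e"
    using eventually_ge_at_top[of k]
  proof eventually_elim
    case (elim n)
    let ?S = "\<lambda>i. SUP \<theta>\<in>{0<..<1}. \<bar>P n i \<theta> - Q n i \<theta>\<bar>"
    have S: "0 \<le> ?S i \<and> ?S i \<le> e / 2" if "i \<in> {1..n}" for i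
    proof
      have bdd: "bdd_above ((\<lambda>\<theta>. \<bar>P n i \<theta> - Q n i \<theta>\<bar>) ` {0<..<1})"
        using elim(1) that by (intro bdd_aboveI[of _ "e / 2"]) auto
      show "0 \<le> ?S i"
        by (rule cSUP_upper2[OF bdd, of "1 / 2"]) auto
      show "?S i \<le> e / 2"
        using elim(1) that by (intro cSUP_least) auto
    qed
    \<comment> \<open>From \<open>n \<ge> k \<ge> 1\<close> the index set is nonempty, so the
      maximum is attained.\<close>
    have "Max (?S ` {1..n}) \<in> ?S ` {1..n}"
      using elim(2) k_pos by (intro Max_in) auto
    then obtain i where "i \<in> {1..n}" "Max (?S ` {1..n}) = ?S i"
      by auto
    then show ?case
      using S[of i] \<open>e > 0\<close> by (simp add: dist_real_def)
  qed
qed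

end

section \<open>From manifest distributions to equal mixed moments\<close>

theorem theorem1:
  fixes k :: nat
    and F :: "nat \<Rightarrow> (nat \<Rightarrow> nat) measure"
    and P P' :: "nat \<Rightarrow> nat \<Rightarrow> real \<Rightarrow> real"
    and \<Omega> :: "nat \<Rightarrow> 'a measure" and \<Theta> :: "nat \<Rightarrow> 'a \<Rightarrow> real" and Y :: "nat \<Rightarrow> nat \<Rightarrow> 'a \<Rightarrow> nat"
    and \<Omega>' :: "nat \<Rightarrow> 'b measure" and \<Theta>' :: "nat \<Rightarrow> 'b \<Rightarrow> real" and Y' :: "nat \<Rightarrow> nat \<Rightarrow> 'b \<Rightarrow> nat"
  assumes "k \<ge> 1"
    and "irf_sequence k P" and "irf_sequence k P'"
    and "\<And>n. n \<ge> k \<Longrightarrow> response_vector n (\<Omega> n) (Y n) (F n)"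
    and "\<And>n. n \<ge> k \<Longrightarrow> response_vector n (\<Omega>' n) (Y' n) (F n)"
    and "\<And>n. n \<ge> k \<Longrightarrow> response_functions n (\<Omega> n) (\<Theta> n) (Y n) (P n)"
    and "\<And>n. n \<ge> k \<Longrightarrow> response_functions n (\<Omega>' n) (\<Theta>' n) (Y' n) (P' n)"
    and "is_model k P F" and "is_model k P' F"
    and "\<And>n. n \<ge> k \<Longrightarrow> locally_independent n (\<Omega> n) (\<Theta> n) (Y n)"
    and "\<And>n. n \<ge> k \<Longrightarrow> locally_independent n (\<Omega>' n) (\<Theta>' n) (Y' n)"
    and "\<And>n. n \<ge> k \<Longrightarrow> uniform_latent (\<Omega> n) (\<Theta> n)"
    and "\<And>n. n \<ge> k \<Longrightarrow> uniform_latent (\<Omega>' n) (\<Theta>' n)"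
    and "smooth_increasing k P" and "smooth_increasing k P'"
    and "uniform_tails k P" and "uniform_tails k P'"
  shows "(\<lambda>n. MAX i\<in>{1..n}. SUP \<theta>\<in>{0<..<1}. \<bar>P n i \<theta> - P' n i \<theta>\<bar>) \<longlonglongrightarrow> 0"
proof -
  have moments: "(\<integral>\<theta>. (\<Prod>i\<in>I. P n i \<theta>) \<partial>unit_space) = (\<integral>\<theta>. (\<Prod>i\<in>I. P' n i \<theta>) \<partial>unit_space)"
    if "n \<ge> k" "I \<subseteq> {1..n}" for n I
  \<comment> \<open>\<open>is_model\<close> covers nonempty sets, where both integrals equal the
    same probability under \<open>F n\<close>; the empty product is 1 on both sides.\<close>
  proof (cases "I = {}")
    case False
    with that have I: "I \<subseteq> {1..n} \<and> I \<noteq> {}" by simp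
    note model = \<open>is_model k P F\<close>[unfolded is_model_def set_integral_unit_space, rule_format, OF that(1) I]
      and model' = \<open>is_model k P' F\<close>[unfolded is_model_def set_integral_unit_space, rule_format, OF that(1) I]
    show ?thesis
      by (rule trans[OF model[symmetric] model'])
  qed simp
  interpret irf_array_pair k P P'
    by unfold_locales (rule assms moments; assumption?)+
  show ?thesis
    by (rule max_sup_tendsto)
qed

end
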